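(* Let $\phi$ be a continuous gauge and let $X$ be a separable metric space. If $E\subseteq X$ and $\mathscr H^\phi(E)=0$, then there is $s\in\mathbb S$ such that $\phi\circ s\in\ell^1$ (i.e. $\sum_{n\geq1}\phi(s_n)<\infty$) and $E$ is $\overline s$-dominated. In other words, $$\mathcal N(\mathscr H^\phi)=\bigcup\{\mathcal D_X(\overline s): s\in\mathbb S,\ \phi\circ s\in\ell^1\}.$$
   Context: $\mathbb S$ is the set of all strictly decreasing sequences $s=(s_n)_{n\geq1}$ of positive reals converging to $0$. For $s\in\mathbb S$ and $k\geq1$ let $s^{\times k}=(s_{kn})_{n\geq1}$, and let $\overline s=\{s^{\times k}:k\geq1\}$. For $S\subseteq\mathbb S$, a set $E\subseteq X$ is $S$-dominated if for each $t\in S$ there is a sequence $(E_n)_{n\geq1}$ of subsets of $X$ that covers $E$ and satisfies $\operatorname{diam}E_n<t_n$ for all $n$; $\mathcal D_X(S)$ is the family of all $S$-dominated subsets of $X$. A gauge is a non-decreasing right-continuous function $\phi\colon[0,\infty)\to[0,\infty)$ with $\phi(0)=0$ and $\phi(r)>0$ for $r>0$. The Hausdorff measure on $X$ is $\mathscr H^\phi(E)=\sup_{\delta>0}\inf\{\sum_n\phi(\operatorname{diam}E_n):\{E_n\}\text{ a countable cover of }E\text{ by subsets of }X\text{ with }\operatorname{diam}E_n<\delta\text{ for all }n\}$, and $\mathcal N(\mathscr H^\phi)=\{E\subseteq X:\mathscr H^\phi(E)=0\}$. *)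

theory Defs
  imports "HOL-Analysis.Analysis"
begin

text \<open>
  Sequences are functions on \<^typ>\<open>nat\<close> indexed from 1; the value at 0 is arbitrary and never used.
\<close>

definition null_seqs :: "(nat \<Rightarrow> real) set" where
  "null_seqs = {s. strict_antimono_on {1..} s \<and> (\<forall>n\<ge>1. 0 < s n) \<and> s \<longlonglongrightarrow> 0}"

definition dilate :: "nat \<Rightarrow> (nat \<Rightarrow> real) \<Rightarrow> nat \<Rightarrow> real" where
  "dilate k s = (\<lambda>n. s (k * n))"

definition dilates :: "(nat \<Rightarrow> real) \<Rightarrow> (nat \<Rightarrow> real) set" where
  "dilates s = {dilate k s | k. 1 \<le> k}"

text \<open>
  The library's \<^const>\<open>diameter\<close> is real-valued and meaningful only on bounded sets, whereas an
  unbounded set has infinite diameter; hence the boundedness condition.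
\<close>

definition diam_less :: "'a::metric_space set \<Rightarrow> real \<Rightarrow> bool" where
  "diam_less A r \<longleftrightarrow> bounded A \<and> diameter A < r"

definition dominated :: "(nat \<Rightarrow> real) set \<Rightarrow> 'a::metric_space set set" where
  "dominated S = {E. \<forall>t\<in>S. \<exists>C :: nat \<Rightarrow> 'a set.
     E \<subseteq> (\<Union>n\<in>{1..}. C n) \<and> (\<forall>n\<ge>1. diam_less (C n) (t n))}"

text \<open>
  Gauges are functions on $[0,\infty)$; the values at negative arguments are arbitrary.
\<close>

definition hausdorff_gauge :: "(real \<Rightarrow> real) \<Rightarrow> bool" where
  "hausdorff_gauge \<phi> \<longleftrightarrow>
     mono_on {0..} \<phi> \<and> (\<forall>r\<ge>0. continuous (at_right r) \<phi>) \<and>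
     \<phi> 0 = 0 \<and> (\<forall>r>0. 0 < \<phi> r)"

text \<open>
  Finite covers are included among the sequences below: they are padded with empty sets, which
  contribute 0 because \<^prop>\<open>diameter {} = 0\<close> and a gauge vanishes at 0.
\<close>

definition hausdorff_measure :: "(real \<Rightarrow> real) \<Rightarrow> 'a::metric_space set \<Rightarrow> ennreal" where
  "hausdorff_measure \<phi> E =
     (SUP \<delta>\<in>{0<..}. INF C\<in>{C :: nat \<Rightarrow> 'a set. E \<subseteq> (\<Union>n. C n) \<and> (\<forall>n. diam_less (C n) \<delta>)}.
        \<Sum>n. ennreal (\<phi> (diameter (C n))))"

definition hausdorff_null_sets :: "(real \<Rightarrow> real) \<Rightarrow> 'a::metric_space set set" where
  "hausdorff_null_sets \<phi> = {E. hausdorff_measure \<phi> E = 0}"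

end

theory Submission
  imports Defs
begin

text \<open>
  \<^bold>\<open>From null to dominated.\<close> Let \<open>E\<close> be null. For each \<open>k\<close> there is a cover \<open>C k\<close> of \<open>E\<close> whose
  gauge sum is as small as desired, and by right-continuity of the gauge there is even room for
  numbers \<open>b k n\<close> strictly above the diameters with \<open>(\<Sum>n. \<phi> (b k n)) \<le> (1 / 2) ^ k / (k + 1)\<close>
  (\<open>null_cover_with_margins\<close>). To serve the dilation by \<open>k\<close>, the sequence \<open>s\<close> must descend \<open>k\<close> times
  more slowly than the cover \<open>C k\<close>, so \<open>k\<close> numbers \<open>d (k, n, i)\<close>, \<open>i < k\<close>, are placed in the
  gap between the diameter of \<open>C k n\<close> and \<open>b k n\<close>. The total gauge sum of all these numbers is at most
  \<open>\<Sum>k. k * (1 / 2) ^ k / (k + 1) < \<infinity>\<close> (\<open>summable_gauge_of_copies\<close>). The gaps are non-degenerate, so the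
  numbers can be taken pairwise distinct (\<open>inj_selection_in_intervals\<close>); since the gauge sum is
  finite, only finitely many of them exceed any given positive bound, and so they can be listed in
  strictly decreasing order (\<open>decreasing_enumeration\<close>). This list is \<open>s\<close>.

  If the sets \<open>C k n\<close> are now put in decreasing order of the least of their \<open>k\<close> numbers, then
  each of the first \<open>m\<close> of them contributes \<open>k\<close> terms of \<open>s\<close> that are at least as large as the least
  number of the \<open>m\<close>-th one. That number is therefore at most \<open>s (k * m)\<close>, and it exceeds the diameter
  of the \<open>m\<close>-th set (\<open>cover_reindexing\<close>).

  \<^bold>\<open>From dominated to null.\<close> As \<open>\<phi> \<circ> s\<close> decreases, each \<open>\<phi> (s (k * n))\<close> is at most the average
  of the block of \<open>k\<close> terms ending in it, so a cover with diameters below \<open>s (k * n)\<close> has gauge sum at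
  most \<open>(\<Sum>n. \<phi> (s n)) / k\<close> (\<open>sum_dilate_le\<close>), which tends to \<open>0\<close> along with the mesh \<open>s k\<close>.
\<close>

section \<open>Perturbing and sorting\<close>

text \<open>
  Choose one index after the other in the order of an enumeration of the index type: only finitely
  many values have been used before, and an open interval is infinite.
\<close>
lemma inj_selection_in_intervals:
  fixes a b :: "'i::countable \<Rightarrow> real"
  assumes "\<And>i. a i < b i"
  obtains d where "inj d" "\<And>i. a i < d i" "\<And>i. d i < b i"
proof -
  let ?R = "inv_image less_than (to_nat :: 'i \<Rightarrow> nat)"
  let ?P = "\<lambda>f x r. a x < r \<and> r < b x \<and> (\<forall>y. (y, x) \<in> ?R \<longrightarrow> r \<noteq> f y)"
  have "\<exists>f. \<forall>x. ?P f x (f x)"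
  proof (rule dependent_wf_choice)
    show "wf ?R"
      by simp
    show "?P f x r = ?P g x r" if "\<And>z. (z, x) \<in> ?R \<Longrightarrow> f z = g z" for f g x r
      using that by auto
    show "\<exists>r. ?P f x r" for x f
    proof -
      have "finite {y. (y, x) \<in> ?R}"
        using finite_vimageI[OF finite_lessThan[of "to_nat x"] inj_to_nat] by (simp add: vimage_def)
      then have "infinite ({a x <..< b x} - f ` {y. (y, x) \<in> ?R})"
        by (intro Diff_infinite_finite finite_imageI) (use assms in \<open>auto simp: infinite_Ioo\<close>)
      then obtain r where "r \<in> {a x <..< b x} - f ` {y. (y, x) \<in> ?R}"
        using infinite_imp_nonempty by blast
      then show ?thesis
        by (intro exI[of _ r]) auto
    qed
  qed
  then obtain d where d: "\<And>x. ?P d x (d x)"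
    by blast
  have "inj d"
  proof (rule injI)
    fix x y assume "d x = d y"
    then have "\<not> to_nat x < to_nat y" "\<not> to_nat y < to_nat x"
      using d[of x] d[of y] by auto
    then show "x = y"
      by (simp add: linorder_neq_iff)
  qed
  with d show ?thesis
    by (intro that[of d]) auto
qed

lemma range_Suc_eq: "range Suc = {1..}"
  by (simp add: atLeast_Suc_greaterThan greaterThan_0)

lemma null_seqs_less_iff:
  assumes "s \<in> null_seqs" "1 \<le> m" "1 \<le> n"
  shows "s m < s n \<longleftrightarrow> n < m"
proof -
  have anti: "monotone_on {1..} (<) (>) s"
    using assms(1) by (simp add: null_seqs_def)
  show ?thesis
    using monotone_onD[OF anti, of m n] monotone_onD[OF anti, of n m] assms(2,3)
    by (cases m n rule: linorder_cases) simp_all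
qed

lemma null_seqs_le_iff:
  assumes "s \<in> null_seqs" "1 \<le> m" "1 \<le> n"
  shows "s m \<le> s n \<longleftrightarrow> n \<le> m"
  unfolding linorder_not_less[symmetric] null_seqs_less_iff[OF assms(1) assms(3,2)] ..

lemma null_seqs_inj_on:
  assumes "s \<in> null_seqs"
  shows "inj_on s {1..}"
proof (rule inj_onI)
  fix m n assume "m \<in> {1..}" "n \<in> {1..}" "s m = s n"
  then show "m = n"
    using null_seqs_le_iff[OF assms, of m n] null_seqs_le_iff[OF assms, of n m] by simp
qed

text \<open>
  The position of \<open>a\<close> in the list is its rank, the number of elements of \<open>A\<close> that are at least \<open>a\<close>.
  The rank is injective and every positive number occurs as a rank, so \<open>s\<close> is its inverse.
\<close>
lemma decreasing_enumeration:
  fixes A :: "real set"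
  assumes inf: "infinite A" and pos: "\<And>a. a \<in> A \<Longrightarrow> 0 < a"
    and fin: "\<And>r. 0 < r \<Longrightarrow> finite {a \<in> A. r \<le> a}"
  obtains s where "s \<in> null_seqs" "s ` {1..} = A"
proof -
  define rank where "rank a = card {b \<in> A. a \<le> b}" for a
  have rank_less: "rank b < rank a" if "a \<in> A" "b \<in> A" "a < b" for a b
    unfolding rank_def
  proof (rule psubset_card_mono)
    have "a \<in> {c \<in> A. a \<le> c} - {c \<in> A. b \<le> c}"
      using that by simp
    moreover have "{c \<in> A. b \<le> c} \<subseteq> {c \<in> A. a \<le> c}"
      using that by auto
    ultimately show "{c \<in> A. b \<le> c} \<subset> {c \<in> A. a \<le> c}"
      by blast
  qed (use that in \<open>auto intro: fin pos\<close>)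
  have inj: "inj_on rank A"
  proof (rule inj_onI)
    fix a b assume "a \<in> A" "b \<in> A" "rank a = rank b"
    then show "a = b"
      using rank_less[of a b] rank_less[of b a] by (cases a b rule: linorder_cases) simp_all
  qed
  have rank_pos: "1 \<le> rank a" if "a \<in> A" for a
    using that fin[of a] pos[of a] unfolding rank_def by (auto simp: Suc_le_eq card_gt_0_iff)
  have surj: "n \<in> rank ` A" if "1 \<le> n" for n
  proof -
    obtain F where F: "finite F" "card F = n" "F \<subseteq> A"
      using infinite_arbitrarily_large[OF inf] by blast
    then have "F \<noteq> {}"
      using that by auto
    define m where "m = Min F"
    have m: "m \<in> A"
      using F \<open>F \<noteq> {}\<close> unfolding m_def by (meson Min_in subsetD)
    \<comment> \<open>The rank maps the finite set of elements above \<open>m\<close> injectively into an initial segment of the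
      same size, so by counting it reaches every number up to the rank of \<open>m\<close>.\<close>
    let ?B = "{b \<in> A. m \<le> b}"
    have "finite ?B"
      using fin pos m by blast
    have "n \<le> rank m"
      using card_mono[OF \<open>finite ?B\<close>, of F] F by (auto simp: rank_def m_def subset_iff)
    have "rank ` ?B = {1..card ?B}"
    proof (rule card_subset_eq)
      have "rank b \<le> card ?B" if "b \<in> ?B" for b
        unfolding rank_def using that by (intro card_mono \<open>finite ?B\<close>) auto
      then show "rank ` ?B \<subseteq> {1..card ?B}"
        using rank_pos by fastforce
      show "card (rank ` ?B) = card {1..card ?B}"
        using card_image[OF inj_on_subset[OF inj, of ?B]] by auto
    qed auto
    then have "n \<in> rank ` ?B"
      using that \<open>n \<le> rank m\<close> by (auto simp: rank_def)
    then show ?thesis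
      by auto
  qed
  have bij: "bij_betw rank A {1..}"
    using inj surj rank_pos by (auto simp: bij_betw_def)
  define s where "s = inv_into A rank"
  have s: "s n \<in> A" "rank (s n) = n" if "1 \<le> n" for n
    using that surj unfolding s_def by (auto intro: inv_into_into f_inv_into_f)
  have anti: "s n < s m" if "1 \<le> m" "m < n" for m n
    using that s[of m] s[of n] rank_less[of "s m" "s n"] by (cases "s m" "s n" rule: linorder_cases) auto
  have "s \<longlonglongrightarrow> 0"
  proof (rule LIMSEQ_I)
    fix r :: real assume "0 < r"
    show "\<exists>N. \<forall>n\<ge>N. norm (s n - 0) < r"
    proof (intro exI allI impI)
      fix n assume n: "Suc (card {a \<in> A. r \<le> a}) \<le> n"
      have "s n < r"
      proof (rule ccontr)
        assume "\<not> s n < r"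
        then have "rank (s n) \<le> card {a \<in> A. r \<le> a}"
          unfolding rank_def by (intro card_mono fin \<open>0 < r\<close>) auto
        then show False
          using n s by simp
      qed
      then show "norm (s n - 0) < r"
        using n s[of n] pos[of "s n"] by simp
    qed
  qed
  then have "s \<in> null_seqs"
    unfolding null_seqs_def using anti s pos by (auto intro!: monotone_onI)
  moreover have "s ` {1..} = A"
    using bij_betw_inv_into[OF bij] by (simp add: s_def bij_betw_def)
  ultimately show ?thesis
    by (rule that)
qed

lemma null_seqs_finite_ge:
  assumes s: "s \<in> null_seqs" and "0 < r"
  shows "finite {a \<in> s ` {1..}. r \<le> a}"
proof -
  have "\<forall>\<^sub>F n in sequentially. s n < r"
    using s \<open>0 < r\<close> unfolding null_seqs_def by (auto intro: order_tendstoD)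
  then obtain N where N: "\<And>n. N \<le> n \<Longrightarrow> s n < r"
    unfolding eventually_sequentially by blast
  have "n < N" if "r \<le> s n" for n
    using N[of n] that by linarith
  then have "{a \<in> s ` {1..}. r \<le> a} \<subseteq> s ` {..<N}"
    by blast
  then show ?thesis
    by (rule finite_subset) auto
qed

lemma null_seqs_image_ge:
  assumes "s \<in> null_seqs" "1 \<le> m"
  shows "{a \<in> s ` {1..}. s m \<le> a} = s ` {1..m}"
proof (intro subset_antisym subsetI)
  fix a assume "a \<in> {a \<in> s ` {1..}. s m \<le> a}"
  then obtain n where "1 \<le> n" "a = s n" "s m \<le> s n"
    by auto
  then show "a \<in> s ` {1..m}"
    using null_seqs_le_iff[OF assms, of n] by simp
next
  fix a assume "a \<in> s ` {1..m}"
  then obtain n where "1 \<le> n" "n \<le> m" "a = s n"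
    by auto
  then show "a \<in> {a \<in> s ` {1..}. s m \<le> a}"
    using null_seqs_le_iff[OF assms, of n] by simp
qed

lemma le_null_seq_if_card_ge:
  assumes s: "s \<in> null_seqs" and r: "r \<in> s ` {1..}" and "1 \<le> m"
    and card: "m \<le> card {a \<in> s ` {1..}. r \<le> a}"
  shows "r \<le> s m"
proof -
  obtain j where j: "1 \<le> j" "r = s j"
    using r by auto
  have "inj_on s {1..j}"
    by (rule inj_on_subset[OF null_seqs_inj_on[OF s]]) auto
  then have "card {a \<in> s ` {1..}. r \<le> a} = j"
    using null_seqs_image_ge[OF s j(1)] j(2) by (simp add: card_image)
  then show ?thesis
    using card null_seqs_le_iff[OF s j(1) \<open>1 \<le> m\<close>] j by simp
qed


text \<open>
  Here \<open>d n 0, \<dots>, d n (k - 1)\<close> are \<open>k\<close> terms of \<open>s\<close> reserved for the \<open>n\<close>-th member of a cover; the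
  function \<open>g\<close> sorts the members so that the \<open>m\<close>-th one has a reserved term at or after position
  \<open>k * m\<close>. The reason is a count: sorted by their least reserved terms, the first \<open>m\<close> members together
  have \<open>k * m\<close> distinct reserved terms, none of them below the least reserved term of the \<open>m\<close>-th member.
\<close>
lemma cover_reindexing:
  fixes d :: "nat \<Rightarrow> nat \<Rightarrow> real"
  assumes s: "s \<in> null_seqs" and k: "1 \<le> k"
    and inj: "inj_on (\<lambda>(n, i). d n i) (UNIV \<times> {..<k})"
    and in_s: "\<And>n i. i < k \<Longrightarrow> d n i \<in> s ` {1..}"
  obtains g :: "nat \<Rightarrow> nat"
  where "g ` {1..} = UNIV" "\<And>m. 1 \<le> m \<Longrightarrow> \<exists>i<k. d (g m) i \<le> s (k * m)"
proof -
  define e where "e n = Min (d n ` {..<k})" for n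
  have ne: "d n ` {..<k} \<noteq> {}" for n
    using k by (auto simp: lessThan_empty_iff)
  have "e n \<in> d n ` {..<k}" for n
    unfolding e_def using ne by (intro Min_in) auto
  then have e_mem: "\<exists>i<k. e n = d n i" for n
    by blast
  have e_le: "e n \<le> d n i" if "i < k" for n i
    unfolding e_def using that by (intro Min_le) auto
  have "inj e"
  proof (rule injI)
    fix n n' assume eq: "e n = e n'"
    obtain i i' where "i < k" "i' < k" "d n i = d n' i'"
      using e_mem[of n] e_mem[of n'] eq by auto
    then show "n = n'"
      using inj_onD[OF inj, of "(n, i)" "(n', i')"] by simp
  qed
  have range_e: "range e \<subseteq> s ` {1..}"
  proof clarify
    fix n
    obtain i where "i < k" "e n = d n i"
      using e_mem by blast
    then show "e n \<in> s ` {1..}"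
      using in_s by simp
  qed
  have s_pos: "0 < a" if "a \<in> s ` {1..}" for a
    using s that unfolding null_seqs_def by auto
  obtain u where u: "u \<in> null_seqs" "u ` {1..} = range e"
  proof (rule decreasing_enumeration)
    show "infinite (range e)"
      using range_inj_infinite[OF \<open>inj e\<close>] .
    show "0 < a" if "a \<in> range e" for a
      using that range_e s_pos by blast
    show "finite {a \<in> range e. r \<le> a}" if "0 < r" for r
      by (rule finite_subset[OF _ null_seqs_finite_ge[OF s that]]) (use range_e in auto)
  qed
  define g where "g m = inv e (u m)" for m
  have e_g: "e (g m) = u m" if "1 \<le> m" for m
    unfolding g_def using that u(2) by (intro f_inv_into_f) auto
  have inj_g: "inj_on g {1..}"
  proof (rule inj_onI)
    fix m n assume mn: "m \<in> {1..}" "n \<in> {1..}" "g m = g n"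
    then have "u m = u n"
      using e_g[of m] e_g[of n] by simp
    then show "m = n"
      using inj_onD[OF null_seqs_inj_on[OF u(1)]] mn by blast
  qed
  have "g ` {1..} = inv e ` range e"
    unfolding u(2)[symmetric] g_def by (simp add: image_image)
  then have surj: "g ` {1..} = UNIV"
    using \<open>inj e\<close> by (simp add: image_image)
  have bound: "u m \<le> s (k * m)" if m: "1 \<le> m" for m
  proof (rule le_null_seq_if_card_ge[OF s])
    show "u m \<in> s ` {1..}"
      using m u(2) range_e by blast
    show "1 \<le> k * m"
      using k m by simp
    let ?D = "(\<lambda>(n, i). d n i) ` (g ` {1..m} \<times> {..<k})"
    have "card (g ` {1..m}) = m"
      using card_image[OF inj_on_subset[OF inj_g, of "{1..m}"]] by auto
    moreover have "inj_on (\<lambda>(n, i). d n i) (g ` {1..m} \<times> {..<k})"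
      using inj by (rule inj_on_subset) auto
    ultimately have "k * m = card ?D"
      by (simp add: card_image card_cartesian_product)
    also have "\<dots> \<le> card {a \<in> s ` {1..}. u m \<le> a}"
    proof (rule card_mono)
      show "finite {a \<in> s ` {1..}. u m \<le> a}"
        using m u(1) by (intro null_seqs_finite_ge[OF s]) (auto simp: null_seqs_def)
      have "u m \<le> d (g j) i" if "1 \<le> j" "j \<le> m" "i < k" for j i
        using null_seqs_le_iff[OF u(1) m \<open>1 \<le> j\<close>] e_le[OF \<open>i < k\<close>, of "g j"] e_g[OF \<open>1 \<le> j\<close>] \<open>j \<le> m\<close>
        by linarith
      then show "?D \<subseteq> {a \<in> s ` {1..}. u m \<le> a}"
        using in_s by auto
    qed
    finally show "k * m \<le> card {a \<in> s ` {1..}. u m \<le> a}" .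
  qed
  show ?thesis
  proof (rule that[OF surj])
    fix m :: nat assume "1 \<le> m"
    then show "\<exists>i<k. d (g m) i \<le> s (k * m)"
      using bound[of m] e_g[of m] e_mem[of "g m"] by metis
  qed
qed

section \<open>Gauges\<close>

lemma hausdorff_gauge_mono:
  "hausdorff_gauge \<phi> \<Longrightarrow> 0 \<le> x \<Longrightarrow> x \<le> y \<Longrightarrow> \<phi> x \<le> \<phi> y"
  using mono_onD[of "{0..}" \<phi> x y] by (simp add: hausdorff_gauge_def)

lemma hausdorff_gauge_nonneg: "hausdorff_gauge \<phi> \<Longrightarrow> 0 \<le> x \<Longrightarrow> 0 \<le> \<phi> x"
  using hausdorff_gauge_mono[of \<phi> 0 x] by (simp add: hausdorff_gauge_def)

text \<open>
  Each index with \<open>r \<le> d i\<close> contributes at least \<open>\<phi> r > 0\<close> to a finite sum.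
\<close>
lemma finite_ge_of_summable_gauge:
  assumes \<phi>: "hausdorff_gauge \<phi>" and sum: "(\<lambda>i. \<phi> (d i)) summable_on I"
    and "0 < r"
  shows "finite {i \<in> I. r \<le> d i}"
proof (rule ccontr)
  let ?J = "{i \<in> I. r \<le> d i}"
  assume "infinite ?J"
  have "0 < \<phi> r"
    using \<phi> \<open>0 < r\<close> by (simp add: hausdorff_gauge_def)
  have "(\<lambda>i. \<phi> (d i)) summable_on ?J"
    using sum by (rule summable_on_subset_banach) auto
  then have "(\<lambda>i. \<phi> r) summable_on ?J"
    by (rule summable_on_comparison_test)
       (use hausdorff_gauge_mono[OF \<phi>] \<open>0 < \<phi> r\<close> \<open>0 < r\<close> in auto)
  then show False
    using infsum_diverge_constant[OF \<open>infinite ?J\<close>, of "\<phi> r"] \<open>0 < \<phi> r\<close> by auto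
qed

lemma hausdorff_gauge_enlarge:
  assumes \<phi>: "hausdorff_gauge \<phi>" and "0 \<le> r" "0 < \<epsilon>"
  obtains b where "r < b" "\<phi> b < \<phi> r + \<epsilon>"
proof -
  have "(\<phi> \<longlongrightarrow> \<phi> r) (at_right r)"
    using \<phi> \<open>0 \<le> r\<close> by (simp add: hausdorff_gauge_def continuous_within)
  then have "\<forall>\<^sub>F x in at_right r. \<phi> x < \<phi> r + \<epsilon>"
    by (rule order_tendstoD) (use \<open>0 < \<epsilon>\<close> in simp)
  then obtain c where "c > r" "\<And>y. r < y \<Longrightarrow> y < c \<Longrightarrow> \<phi> y < \<phi> r + \<epsilon>"
    unfolding eventually_at_right_field by blast
  then show ?thesis
    using that dense by metis
qed

text \<open>
  Positive margins above the diameters make room for perturbation; they also turn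
  empty sets and singletons, whose diameter is \<open>0\<close>, into members with a positive bound.
\<close>
lemma null_cover_with_margins:
  assumes \<phi>: "hausdorff_gauge \<phi>" and null: "hausdorff_measure \<phi> E = 0" and "0 < \<epsilon>"
  obtains C b where "E \<subseteq> (\<Union>n. C n)" "\<And>n. bounded (C n)" "\<And>n. diameter (C n) < b n"
    "summable (\<lambda>n. \<phi> (b n))" "(\<Sum>n. \<phi> (b n)) \<le> \<epsilon>"
proof -
  let ?cov = "{C :: nat \<Rightarrow> 'a set. E \<subseteq> (\<Union>n. C n) \<and> (\<forall>n. diam_less (C n) 1)}"
  \<comment> \<open>Any single mesh would do in place of 1: in a null set the infimum vanishes for every mesh.\<close>
  have "(INF C\<in>?cov. \<Sum>n. ennreal (\<phi> (diameter (C n)))) \<le> hausdorff_measure \<phi> E"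
    unfolding hausdorff_measure_def by (rule SUP_upper2[of 1]) auto
  also have "\<dots> < ennreal (\<epsilon> / 2)"
    using null \<open>0 < \<epsilon>\<close> by simp
  finally obtain C where C: "E \<subseteq> (\<Union>n. C n)" "\<And>n. bounded (C n)"
    and lt: "(\<Sum>n. ennreal (\<phi> (diameter (C n)))) < ennreal (\<epsilon> / 2)"
    unfolding INF_less_iff diam_less_def by auto
  have nonneg: "0 \<le> \<phi> (diameter (C n))" for n
    by (simp add: C diameter_ge_0 hausdorff_gauge_nonneg[OF \<phi>])
  have summ: "summable (\<lambda>n. \<phi> (diameter (C n)))"
    by (rule summable_suminf_not_top) (use nonneg lt in auto)
  have sum_le: "(\<Sum>n. \<phi> (diameter (C n))) \<le> \<epsilon> / 2"
    using lt suminf_ennreal2[OF nonneg summ] \<open>0 < \<epsilon>\<close> by (simp add: ennreal_less_iff suminf_nonneg nonneg summ)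
  \<comment> \<open>One half of \<open>\<epsilon>\<close> pays for the cover, the other half is spread geometrically over the margins.\<close>
  have "\<exists>b. diameter (C n) < b \<and> \<phi> b < \<phi> (diameter (C n)) + \<epsilon> / 2 * (1 / 2) ^ Suc n" for n
    using hausdorff_gauge_enlarge[OF \<phi> diameter_ge_0[OF C(2)[of n]], of "\<epsilon> / 2 * (1 / 2) ^ Suc n"] \<open>0 < \<epsilon>\<close>
    by auto
  then obtain b where b: "\<And>n. diameter (C n) < b n"
    "\<And>n. \<phi> (b n) < \<phi> (diameter (C n)) + \<epsilon> / 2 * (1 / 2) ^ Suc n"
    by metis
  have geo: "(\<lambda>n. \<epsilon> / 2 * (1 / 2) ^ Suc n) sums (\<epsilon> / 2)"
    using sums_mult[OF power_half_series, of "\<epsilon> / 2"] by simp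
  have sums: "(\<lambda>n. \<phi> (diameter (C n)) + \<epsilon> / 2 * (1 / 2) ^ Suc n) sums ((\<Sum>n. \<phi> (diameter (C n))) + \<epsilon> / 2)"
    by (intro sums_add geo summable_sums summ)
  have "0 \<le> \<phi> (b n)" for n
    using hausdorff_gauge_nonneg[OF \<phi>] diameter_ge_0[OF C(2)[of n]] b(1)[of n] by auto
  then have summ_b: "summable (\<lambda>n. \<phi> (b n))"
    by (intro summable_comparison_test'[OF sums_summable[OF sums], of 0]) (use b(2) in \<open>auto intro: less_imp_le\<close>)
  have "(\<Sum>n. \<phi> (b n)) \<le> (\<Sum>n. \<phi> (diameter (C n))) + \<epsilon> / 2"
    by (rule sums_le[OF _ summable_sums[OF summ_b] sums]) (use b(2) in \<open>auto intro: less_imp_le\<close>)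
  with sum_le have "(\<Sum>n. \<phi> (b n)) \<le> \<epsilon>"
    by simp
  with C b(1) summ_b show ?thesis
    by (intro that)
qed

section \<open>Null sets are dominated\<close>

lemma summable_gauge_of_enumeration:
  assumes \<phi>: "hausdorff_gauge \<phi>" and s: "s \<in> null_seqs" and "s ` {1..} = d ` I" and inj: "inj_on d I"
    and sum: "(\<lambda>i. \<phi> (d i)) summable_on I"
  shows "summable (\<lambda>n. \<phi> (s (Suc n)))"
proof -
  have bij: "bij_betw (\<lambda>n. s (Suc n)) UNIV (d ` I)"
    using bij_betw_trans[of Suc UNIV "{1..}" s "d ` I"] null_seqs_inj_on[OF s] assms(3) range_Suc_eq
    by (simp add: bij_betw_def o_def)
  have "\<phi> summable_on (d ` I)"
    using sum inj by (simp add: summable_on_reindex o_def)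
  then have "(\<lambda>n. \<phi> (s (Suc n))) summable_on UNIV"
    using summable_on_reindex_bij_betw[OF bij, of \<phi>] by simp
  then show ?thesis
    by (rule summable_on_imp_summable)
qed

text \<open>
  The \<open>k\<close>-th family is used \<open>k\<close> times, and the factor \<open>1 / Suc k\<close> in its bound pays for this
  multiplicity.
\<close>
lemma summable_gauge_of_copies:
  fixes b :: "nat \<Rightarrow> nat \<Rightarrow> real"
  assumes \<phi>: "hausdorff_gauge \<phi>" and pos: "\<And>k n. 0 \<le> b k n"
    and summ: "\<And>k. summable (\<lambda>n. \<phi> (b k n))"
    and le: "\<And>k. (\<Sum>n. \<phi> (b k n)) \<le> (1 / 2) ^ k / Suc k"
  shows "(\<lambda>(k, n, i). \<phi> (b k n)) summable_on (SIGMA k:UNIV. UNIV \<times> {..<k})"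
proof (rule summable_on_SigmaI)
  have nonneg: "0 \<le> \<phi> (b k n)" for k n
    by (rule hausdorff_gauge_nonneg[OF \<phi> pos])
  show "((\<lambda>p. case (k, p) of (k, n, i) \<Rightarrow> \<phi> (b k n)) has_sum k * (\<Sum>n. \<phi> (b k n))) (UNIV \<times> {..<k})" for k
  proof (rule has_sum_SigmaI)
    show "((\<lambda>i. case (k, n, i) of (k, n, i) \<Rightarrow> \<phi> (b k n)) has_sum k * \<phi> (b k n)) {..<k}" for n
      by (rule has_sum_finiteI) auto
    show has: "((\<lambda>n. k * \<phi> (b k n)) has_sum k * (\<Sum>n. \<phi> (b k n))) UNIV"
      by (intro sums_nonneg_imp_has_sum sums_mult summable_sums summ) (simp add: nonneg)
    show "(\<lambda>p. case (k, p) of (k, n, i) \<Rightarrow> \<phi> (b k n)) summable_on UNIV \<times> {..<k}"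
      by (rule summable_on_SigmaI[OF _ has_sum_imp_summable[OF has]])
         (auto simp: nonneg intro!: has_sum_finiteI)
  qed
  have "k * (\<Sum>n. \<phi> (b k n)) \<le> (1 / 2) ^ k" for k
  proof -
    have "k * (\<Sum>n. \<phi> (b k n)) \<le> Suc k * (\<Sum>n. \<phi> (b k n))"
      by (intro mult_right_mono suminf_nonneg summ nonneg) auto
    also have "\<dots> \<le> (1 / 2) ^ k"
      using le[of k] by (simp add: pos_le_divide_eq mult.commute)
    finally show ?thesis .
  qed
  moreover have "0 \<le> k * (\<Sum>n. \<phi> (b k n))" for k :: nat
    by (intro mult_nonneg_nonneg suminf_nonneg summ nonneg) auto
  moreover have "(\<lambda>k. (1 / 2 :: real) ^ k) summable_on UNIV"
    by (intro summable_nonneg_imp_summable_on summable_geometric) auto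
  ultimately show "(\<lambda>k. k * (\<Sum>n. \<phi> (b k n))) summable_on UNIV"
    by - (rule summable_on_comparison_test)
  show "0 \<le> (case (k, p) of (k, n, i) \<Rightarrow> \<phi> (b k n))" for k p
    by (cases p) (simp only: prod.case nonneg)
qed

text \<open>
  A triple \<open>(k, n, i)\<close> with \<open>i < k\<close> stands for the \<open>i\<close>-th copy of the \<open>n\<close>-th set of the cover that
  serves the dilation by \<open>k\<close>.
\<close>
lemma null_imp_dominated:
  fixes E :: "'a::metric_space set"
  assumes \<phi>: "hausdorff_gauge \<phi>" and null: "hausdorff_measure \<phi> E = 0"
  shows "\<exists>s\<in>null_seqs. summable (\<lambda>n. \<phi> (s (Suc n))) \<and> E \<in> dominated (dilates s)"
proof -
  have "\<exists>C b. E \<subseteq> (\<Union>n. C n) \<and> (\<forall>n. bounded (C n)) \<and> (\<forall>n. diameter (C n) < b n) \<and>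
      summable (\<lambda>n. \<phi> (b n)) \<and> (\<Sum>n. \<phi> (b n)) \<le> (1 / 2) ^ k / Suc k" for k
    by (rule null_cover_with_margins[OF \<phi> null, of "(1 / 2) ^ k / Suc k"]) auto
  then obtain C :: "nat \<Rightarrow> nat \<Rightarrow> 'a set" and b where
    cover: "\<And>k. E \<subseteq> (\<Union>n. C k n)" and bdd: "\<And>k n. bounded (C k n)"
    and diam_b: "\<And>k n. diameter (C k n) < b k n"
    and b: "\<And>k. summable (\<lambda>n. \<phi> (b k n))" "\<And>k. (\<Sum>n. \<phi> (b k n)) \<le> (1 / 2) ^ k / Suc k"
    by metis
  have b_nonneg: "0 \<le> b k n" for k n
    using diameter_ge_0[OF bdd[of k n]] diam_b[of k n] by linarith
  define lo hi where "lo = (\<lambda>(k, n, i :: nat). diameter (C k n))" and "hi = (\<lambda>(k, n, i :: nat). b k n)"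
  have "lo x < hi x" for x
    unfolding lo_def hi_def using diam_b by (simp add: case_prod_unfold)
  then obtain d where "inj d" and d: "\<And>x. lo x < d x" "\<And>x. d x < hi x"
    using inj_selection_in_intervals[of lo hi] by blast
  have d_gt: "diameter (C k n) < d (k, n, i)" and d_lt: "d (k, n, i) < b k n" for k n i
    using d[of "(k, n, i)"] by (auto simp: lo_def hi_def)
  have d_pos: "0 < d (k, n, i)" for k n i
    using diameter_ge_0[OF bdd] d_gt by (rule le_less_trans)
  define I :: "(nat \<times> nat \<times> nat) set" where "I = (SIGMA k:UNIV. UNIV \<times> {..<k})"
  have inj_I: "inj_on d I"
    using \<open>inj d\<close> by (rule inj_on_subset) auto
  have sum_d: "(\<lambda>x. \<phi> (d x)) summable_on I"
    unfolding I_def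
    by (rule summable_on_comparison_test[OF summable_gauge_of_copies[OF \<phi> b_nonneg b]])
       (auto intro!: hausdorff_gauge_mono[OF \<phi>] hausdorff_gauge_nonneg[OF \<phi>] less_imp_le[OF d_pos] less_imp_le[OF d_lt])
  obtain s where s: "s \<in> null_seqs" "s ` {1..} = d ` I"
  proof (rule decreasing_enumeration)
    \<comment> \<open>Already the single copy of the first cover gives infinitely many indices.\<close>
    have "infinite (range (\<lambda>n :: nat. (Suc 0, n, 0 :: nat)))"
      by (rule range_inj_infinite) (simp add: inj_def)
    moreover have "range (\<lambda>n. (Suc 0, n, 0)) \<subseteq> I"
      by (auto simp: I_def)
    ultimately have "infinite I"
      using finite_subset by blast
    then show "infinite (d ` I)"
      using finite_imageD[OF _ inj_I] by blast
    show "0 < a" if "a \<in> d ` I" for a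
      using that d_pos by auto
    show "finite {a \<in> d ` I. r \<le> a}" if "0 < r" for r
      by (rule finite_subset[OF _ finite_imageI[OF finite_ge_of_summable_gauge[OF \<phi> sum_d that]]]) auto
  qed
  have "E \<in> dominated (dilates s)"
    unfolding dominated_def
  proof (intro CollectI ballI)
    fix t assume "t \<in> dilates s"
    then obtain k where k: "1 \<le> k" "t = dilate k s"
      unfolding dilates_def by auto
    have inj_k: "inj_on (\<lambda>(n, i). d (k, n, i)) (UNIV \<times> {..<k})"
      using injD[OF \<open>inj d\<close>] by (fastforce intro: inj_onI)
    have in_s: "d (k, n, i) \<in> s ` {1..}" if "i < k" for n i
      unfolding s(2) using that by (auto simp: I_def)
    obtain g where g: "g ` {1..} = UNIV" "\<And>m. 1 \<le> m \<Longrightarrow> \<exists>i<k. d (k, g m, i) \<le> s (k * m)"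
      using cover_reindexing[OF s(1) k(1), of "\<lambda>n i. d (k, n, i)", OF inj_k in_s] by blast
    have "E \<subseteq> (\<Union>m\<in>{1..}. C k (g m))"
      using cover[of k] unfolding g(1)[symmetric] by simp
    moreover have "diam_less (C k (g m)) (t m)" if m: "1 \<le> m" for m
    proof -
      obtain i where "d (k, g m, i) \<le> s (k * m)"
        using g(2)[OF m] by blast
      then show ?thesis
        using bdd d_gt[of k "g m" i] unfolding diam_less_def k(2) dilate_def by simp
    qed
    ultimately show "\<exists>C. E \<subseteq> (\<Union>n\<in>{1..}. C n) \<and> (\<forall>n\<ge>1. diam_less (C n) (t n))"
      by (intro exI[of _ "\<lambda>m. C k (g m)"]) simp
  qed
  then show ?thesis
    by (intro bexI[OF _ s(1)] conjI summable_gauge_of_enumeration[OF \<phi> s inj_I sum_d])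
qed

section \<open>Dominated sets are null\<close>

text \<open>
  Since \<open>\<phi> \<circ> s\<close> is non-increasing, \<open>k\<close> times its term at \<open>k * Suc n\<close> is at most the sum over the
  block of \<open>k\<close> consecutive positions ending there, and these blocks are disjoint.
\<close>
lemma sum_dilate_le:
  assumes \<phi>: "hausdorff_gauge \<phi>" and s: "s \<in> null_seqs" and summ: "summable (\<lambda>n. \<phi> (s (Suc n)))"
    and k: "1 \<le> k"
  shows "(\<Sum>n<N. \<phi> (s (k * Suc n))) \<le> (\<Sum>n. \<phi> (s (Suc n))) / k"
proof -
  have s_pos: "0 < s n" if "1 \<le> n" for n
    using s that by (simp add: null_seqs_def)
  have "k * \<phi> (s (k * Suc n)) \<le> (\<Sum>j\<in>{n * k..<n * k + k}. \<phi> (s (Suc j)))" for n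
  proof -
    have "of_nat (card {n * k..<n * k + k}) * \<phi> (s (k * Suc n)) \<le> (\<Sum>j\<in>{n * k..<n * k + k}. \<phi> (s (Suc j)))"
    proof (rule sum_bounded_below)
      fix j assume "j \<in> {n * k..<n * k + k}"
      then have "s (k * Suc n) \<le> s (Suc j)"
        using k by (subst null_seqs_le_iff[OF s]) (auto simp: algebra_simps)
      then show "\<phi> (s (k * Suc n)) \<le> \<phi> (s (Suc j))"
        using k s_pos[of "k * Suc n"] by (intro hausdorff_gauge_mono[OF \<phi>]) auto
    qed
    then show ?thesis
      by simp
  qed
  then have "(\<Sum>n<N. k * \<phi> (s (k * Suc n))) \<le> (\<Sum>n<N. \<Sum>j\<in>{n * k..<n * k + k}. \<phi> (s (Suc j)))"
    by (rule sum_mono)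
  also have "\<dots> = (\<Sum>j<N * k. \<phi> (s (Suc j)))"
    by (rule sum.nat_group)
  also have "\<dots> \<le> (\<Sum>j. \<phi> (s (Suc j)))"
    using hausdorff_gauge_nonneg[OF \<phi> less_imp_le[OF s_pos]] by (intro sum_le_suminf summ) auto
  finally show ?thesis
    using k by (simp add: field_simps flip: sum_distrib_left)
qed

text \<open>
  The cover given by the \<open>k\<close>-th dilate has mesh below \<open>s k\<close> and gauge sum at most \<open>S / k\<close>, where \<open>S\<close> is
  the full sum; for a fixed mesh bound, let \<open>k\<close> tend to infinity.
\<close>
lemma dominated_imp_null:
  fixes E :: "'a::metric_space set"
  assumes \<phi>: "hausdorff_gauge \<phi>" and s: "s \<in> null_seqs" and summ: "summable (\<lambda>n. \<phi> (s (Suc n)))"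
    and dom: "E \<in> dominated (dilates s)"
  shows "hausdorff_measure \<phi> E = 0"
proof -
  define S where "S = (\<Sum>n. \<phi> (s (Suc n)))"
  have s_tendsto: "s \<longlonglongrightarrow> 0"
    using s by (simp add: null_seqs_def)
  have "(INF C\<in>{C :: nat \<Rightarrow> 'a set. E \<subseteq> (\<Union>n. C n) \<and> (\<forall>n. diam_less (C n) \<delta>)}.
      \<Sum>n. ennreal (\<phi> (diameter (C n)))) \<le> 0" (is "?H \<le> 0") if "0 < \<delta>" for \<delta>
  proof (rule tendsto_lowerbound)
    have "(\<lambda>k. S / real k) \<longlonglongrightarrow> 0"
      by (rule lim_const_over_n)
    then show "(\<lambda>k. ennreal (S / real k)) \<longlonglongrightarrow> 0"
      using tendsto_ennrealI by fastforce
    have "\<forall>\<^sub>F k in sequentially. s k < \<delta>"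
      using s_tendsto \<open>0 < \<delta>\<close> by (rule order_tendstoD)
    then show "\<forall>\<^sub>F k in sequentially. ?H \<le> ennreal (S / real k)"
      using eventually_ge_at_top[of 1]
    proof eventually_elim
      case (elim k)
      then have "dilate k s \<in> dilates s"
        by (auto simp: dilates_def)
      moreover have "\<forall>t\<in>dilates s. \<exists>C :: nat \<Rightarrow> 'a set.
          E \<subseteq> (\<Union>n\<in>{1..}. C n) \<and> (\<forall>n\<ge>1. diam_less (C n) (t n))"
        using dom by (simp add: dominated_def)
      ultimately obtain C :: "nat \<Rightarrow> 'a set" where C: "E \<subseteq> (\<Union>n\<in>{1..}. C n)"
          "\<And>n. 1 \<le> n \<Longrightarrow> diam_less (C n) (s (k * n))"
        unfolding dilate_def by meson
      have "E \<subseteq> (\<Union>n. C (Suc n))"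
        using C(1) unfolding range_Suc_eq[symmetric] by (simp add: image_image)
      moreover have "diam_less (C (Suc n)) \<delta>" for n
      proof -
        have "s (k * Suc n) \<le> s k"
          using elim by (subst null_seqs_le_iff[OF s]) auto
        then show ?thesis
          using C(2)[of "Suc n"] elim by (auto simp: diam_less_def)
      qed
      ultimately have "?H \<le> (\<Sum>n. ennreal (\<phi> (diameter (C (Suc n)))))"
        by (intro INF_lower) auto
      also have "\<dots> \<le> ennreal (S / real k)"
        unfolding suminf_eq_SUP
      proof (rule SUP_least)
        fix N
        have diam: "0 \<le> diameter (C (Suc n))" "diameter (C (Suc n)) \<le> s (k * Suc n)" for n
          using C(2)[of "Suc n"] by (auto simp: diam_less_def diameter_ge_0)
        have "(\<Sum>n<N. ennreal (\<phi> (diameter (C (Suc n))))) = ennreal (\<Sum>n<N. \<phi> (diameter (C (Suc n))))"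
          by (intro sum_ennreal hausdorff_gauge_nonneg[OF \<phi>] diam)
        also have "\<dots> \<le> ennreal (\<Sum>n<N. \<phi> (s (k * Suc n)))"
          by (intro ennreal_leI sum_mono hausdorff_gauge_mono[OF \<phi>] diam)
        also have "\<dots> \<le> ennreal (S / real k)"
          unfolding S_def using elim by (intro ennreal_leI sum_dilate_le[OF \<phi> s summ])
        finally show "(\<Sum>n<N. ennreal (\<phi> (diameter (C (Suc n))))) \<le> ennreal (S / real k)" .
      qed
      finally show ?case .
    qed
  qed simp
  then have "hausdorff_measure \<phi> E \<le> 0"
    unfolding hausdorff_measure_def by (intro SUP_least) auto
  then show ?thesis
    by simp
qed

theorem theorem4p5:
  fixes \<phi> :: "real \<Rightarrow> real"
  assumes "hausdorff_gauge \<phi>"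
    and "continuous_on {0..} \<phi>"
    and "separable_space (euclidean :: 'a::metric_space topology)"
  shows "(\<forall>E :: 'a set. hausdorff_measure \<phi> E = 0 \<longrightarrow>
            (\<exists>s\<in>null_seqs. summable (\<lambda>n. \<phi> (s (Suc n))) \<and> E \<in> dominated (dilates s)))
       \<and> (hausdorff_null_sets \<phi> :: 'a set set) =
            \<Union> {dominated (dilates s) | s. s \<in> null_seqs \<and> summable (\<lambda>n. \<phi> (s (Suc n)))}"
proof -
  have null: "\<exists>s\<in>null_seqs. summable (\<lambda>n. \<phi> (s (Suc n))) \<and> E \<in> dominated (dilates s)"
    if "hausdorff_measure \<phi> E = 0" for E :: "'a set"
    using null_imp_dominated[OF assms(1) that] .
  have "(hausdorff_null_sets \<phi> :: 'a set set) =
      \<Union> {dominated (dilates s) | s. s \<in> null_seqs \<and> summable (\<lambda>n. \<phi> (s (Suc n)))}"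
  proof (intro subset_antisym subsetI)
    fix E :: "'a set" assume "E \<in> hausdorff_null_sets \<phi>"
    then show "E \<in> \<Union> {dominated (dilates s) | s. s \<in> null_seqs \<and> summable (\<lambda>n. \<phi> (s (Suc n)))}"
      using null[of E] by (auto simp: hausdorff_null_sets_def)
  next
    fix E :: "'a set"
    assume "E \<in> \<Union> {dominated (dilates s) | s. s \<in> null_seqs \<and> summable (\<lambda>n. \<phi> (s (Suc n)))}"
    then show "E \<in> hausdorff_null_sets \<phi>"
      using dominated_imp_null[OF assms(1)] by (auto simp: hausdorff_null_sets_def)
  qed
  with null show ?thesis
    by simp
qed

end
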